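(* For arbitrarily distributed random variables $X_1,X_2$ (the case $n=2$), $$R(X_1,X_2)=I(X_1;X_2).$$
   Context: Mutual information $I(\cdot;\cdot)$ is measured in bits. $A-B-C$ means that $A,B,C$ form a Markov chain ($A$ and $C$ conditionally independent given $B$). Definition of the higher-order common information (HCI). Let $n\ge2$ and let $\mathcal X=\{X_1,\dots,X_n\}$ be arbitrarily distributed random variables; in $I(\cdot;\mathcal X)$ and in Markov chains, $\mathcal X$ stands for the joint vector $(X_1,\dots,X_n)$. Fix $i\in\{1,\dots,n\}$ and let $\pi^{(i)}$ be an ordering (permutation) of $\{1,\dots,n\}\setminus\{i\}$, with $\pi^{(i)}(\ell)$ its $\ell$-th element, $\ell=1,\dots,n-1$. Set $T_1^{(i)}=X_i$. For $\ell=1,\dots,n-2$ and given $T_\ell^{(i)}$, let $\mathcal A_\ell(T_\ell^{(i)},\pi^{(i)})$ be the set of minimizers $$\arg\inf_{S:\,S-T_\ell^{(i)}-\mathcal X} I(S;\mathcal X)\quad\text{subject to}\quad I(S;T_\ell^{(i)})=I(T_\ell^{(i)};X_{\pi^{(i)}(\ell)}).$$ Here $S$ ranges over deterministic or stochastic functions of $T_\ell^{(i)}$, i.e. $S=f(T_\ell^{(i)},\epsilon)$ with auxiliary randomness $\epsilon$ independent of $(X_1,\dots,X_n)$ and such that the Markov chain holds. Let $\mathcal T_i^{\pi^{(i)}}(\mathcal X)$ be the set of all terminal auxiliaries $T_{n-1}^{(i)}$ obtained from sequences with $T_1^{(i)}=X_i$ and $T_{\ell+1}^{(i)}\in\mathcal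 A_\ell(T_\ell^{(i)},\pi^{(i)})$ for $\ell=1,\dots,n-2$, and let $\mathcal T_i(\mathcal X)=\bigcup_{\pi^{(i)}}\mathcal T_i^{\pi^{(i)}}(\mathcal X)$, the union over all orderings. Then $$R(X_1,\dots,X_n)=\min_{1\le i\le n}\;\sup_{T\in\mathcal T_i(\mathcal X)}\;\min_{1\le j\le n} I(T;X_j).$$ *)

theory Defs
  imports "HOL-Probability.Probability"
begin

(* Mutual information in bits for arbitrary random variables.  The library's real-valued
   mutual_information is only meaningful if the joint law is absolutely continuous with respect to
   the product of the marginals and the information density is integrable (for example it is 0 for
   the pair (X, X) with X Gaussian).  In every other case the relative entropy is infinite: the
   negative part of the information density is always integrable. *)
definition mutual_info ::
  "'w measure \<Rightarrow> 'a measure \<Rightarrow> 'b measure \<Rightarrow> ('w \<Rightarrow> 'a) \<Rightarrow> ('w \<Rightarrow> 'b) \<Rightarrow> ennreal" where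
  "mutual_info M A B X Y =
     (let P = distr M (A \<Otimes>\<^sub>M B) (\<lambda>w. (X w, Y w));
          Q = distr M A X \<Otimes>\<^sub>M distr M B Y
      in if absolutely_continuous Q P \<and> integrable P (entropy_density 2 Q P)
         then ennreal (prob_space.mutual_information M 2 A B X Y)
         else \<infinity>)"

definition sigma_gen :: "'w measure \<Rightarrow> 'b measure \<Rightarrow> ('w \<Rightarrow> 'b) \<Rightarrow> 'w measure" where
  "sigma_gen M B Y = vimage_algebra (space M) Y B"

(* X - Y - Z: X and Z are conditionally independent given the sigma-algebra generated by Y. *)
definition markov_chain ::
  "'w measure \<Rightarrow> 'a measure \<Rightarrow> 'b measure \<Rightarrow> 'c measure
    \<Rightarrow> ('w \<Rightarrow> 'a) \<Rightarrow> ('w \<Rightarrow> 'b) \<Rightarrow> ('w \<Rightarrow> 'c) \<Rightarrow> bool" where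
  "markov_chain M A B C X Y Z \<longleftrightarrow>
     (\<forall>a\<in>sets A. \<forall>c\<in>sets C. AE w in M.
        real_cond_exp M (sigma_gen M B Y) (indicator {v\<in>space M. X v \<in> a \<and> Z v \<in> c}) w =
        real_cond_exp M (sigma_gen M B Y) (indicator {v\<in>space M. X v \<in> a}) w *
        real_cond_exp M (sigma_gen M B Y) (indicator {v\<in>space M. Z v \<in> c}) w)"

type_synonym 'w ext = "'w \<times> (nat \<Rightarrow> real)"

(* The sources live on M.  To have auxiliary randomness available, M is extended by a sequence
   u 1, u 2, ... of independent uniform random variables on [0,1]. *)
definition ext_space :: "'w measure \<Rightarrow> 'w ext measure" where
  "ext_space M = M \<Otimes>\<^sub>M (\<Pi>\<^sub>M k\<in>(UNIV :: nat set). uniform_measure lborel {0..1::real})"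

(* The events that depend only on the original sample point and u 1, ..., u l. *)
definition stage :: "'w measure \<Rightarrow> nat \<Rightarrow> 'w ext measure" where
  "stage M l = vimage_algebra (space (ext_space M)) (\<lambda>(w, u). (w, restrict u {1..l}))
                 (M \<Otimes>\<^sub>M (\<Pi>\<^sub>M k\<in>{1..l}. (borel :: real measure)))"

(* An auxiliary random variable: its alphabet (only the sigma-algebra of the first component
   matters) and the variable itself.  Values lie in the sum type so that, whatever 'a is, the type
   contains the source values and is large enough for arbitrary further auxiliaries. *)
type_synonym ('w, 'a) aux = "('a + real) measure \<times> ('w ext \<Rightarrow> 'a + real)"

(* X i, with values in the measurable space S i, for i = 1, ..., n, and their joint vector, as
   random variables on the extended space. *)
definition src :: "(nat \<Rightarrow> 'w \<Rightarrow> 'a) \<Rightarrow> nat \<Rightarrow> 'w ext \<Rightarrow> 'a" where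
  "src X i = (\<lambda>p. X i (fst p))"

definition joint_alphabet :: "nat \<Rightarrow> (nat \<Rightarrow> 'a measure) \<Rightarrow> (nat \<Rightarrow> 'a) measure" where
  "joint_alphabet n S = (\<Pi>\<^sub>M i\<in>{1..n}. S i)"

definition joint_src :: "nat \<Rightarrow> (nat \<Rightarrow> 'w \<Rightarrow> 'a) \<Rightarrow> 'w ext \<Rightarrow> nat \<Rightarrow> 'a" where
  "joint_src n X = (\<lambda>p. \<lambda>i\<in>{1..n}. src X i p)"

definition info_src ::
  "'w measure \<Rightarrow> (nat \<Rightarrow> 'a measure) \<Rightarrow> (nat \<Rightarrow> 'w \<Rightarrow> 'a) \<Rightarrow> ('w, 'a) aux \<Rightarrow> nat \<Rightarrow> ennreal" where
  "info_src M S X T j = mutual_info (ext_space M) (fst T) (S j) (snd T) (src X j)"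

definition info_joint ::
  "'w measure \<Rightarrow> nat \<Rightarrow> (nat \<Rightarrow> 'a measure) \<Rightarrow> (nat \<Rightarrow> 'w \<Rightarrow> 'a) \<Rightarrow> ('w, 'a) aux \<Rightarrow> ennreal" where
  "info_joint M n S X T =
     mutual_info (ext_space M) (fst T) (joint_alphabet n S) (snd T) (joint_src n X)"

definition info_aux :: "'w measure \<Rightarrow> ('w, 'a) aux \<Rightarrow> ('w, 'a) aux \<Rightarrow> ennreal" where
  "info_aux M V T = mutual_info (ext_space M) (fst V) (fst T) (snd V) (snd T)"

(* V = f(T, e) with e independent of the joint source vector and V - T - (X 1, ..., X n).
   In the l-th step e may use u 1, ..., u l, and T only depends on u 1, ..., u (l - 1); thus u l is
   fresh and every randomization of T is available. *)
definition stochastic_functions ::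
  "'w measure \<Rightarrow> nat \<Rightarrow> (nat \<Rightarrow> 'a measure) \<Rightarrow> (nat \<Rightarrow> 'w \<Rightarrow> 'a) \<Rightarrow> nat \<Rightarrow> ('w, 'a) aux
    \<Rightarrow> ('w, 'a) aux set" where
  "stochastic_functions M n S X l T =
     {V. \<exists>e f. e \<in> borel_measurable (stage M l)
            \<and> prob_space.indep_set (ext_space M)
                 (sets (sigma_gen (ext_space M) borel e))
                 (sets (sigma_gen (ext_space M) (joint_alphabet n S) (joint_src n X)))
            \<and> f \<in> measurable (fst T \<Otimes>\<^sub>M (borel :: real measure)) (fst V)
            \<and> snd V = (\<lambda>p. f (snd T p, e p))
            \<and> markov_chain (ext_space M) (fst V) (fst T) (joint_alphabet n S)
                 (snd V) (snd T) (joint_src n X)}"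

definition feasible ::
  "'w measure \<Rightarrow> nat \<Rightarrow> (nat \<Rightarrow> 'a measure) \<Rightarrow> (nat \<Rightarrow> 'w \<Rightarrow> 'a) \<Rightarrow> nat \<Rightarrow> ('w, 'a) aux
    \<Rightarrow> (nat \<Rightarrow> nat) \<Rightarrow> ('w, 'a) aux set" where
  "feasible M n S X l T \<pi> =
     {V \<in> stochastic_functions M n S X l T. info_aux M V T = info_src M S X T (\<pi> l)}"

definition minimizers ::
  "'w measure \<Rightarrow> nat \<Rightarrow> (nat \<Rightarrow> 'a measure) \<Rightarrow> (nat \<Rightarrow> 'w \<Rightarrow> 'a) \<Rightarrow> nat \<Rightarrow> ('w, 'a) aux
    \<Rightarrow> (nat \<Rightarrow> nat) \<Rightarrow> ('w, 'a) aux set" where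
  "minimizers M n S X l T \<pi> =
     {V \<in> feasible M n S X l T \<pi>.
        info_joint M n S X V = (INF V'\<in>feasible M n S X l T \<pi>. info_joint M n S X V')}"

(* X i as an auxiliary variable. *)
definition initial_aux ::
  "(nat \<Rightarrow> 'a measure) \<Rightarrow> (nat \<Rightarrow> 'w \<Rightarrow> 'a) \<Rightarrow> nat \<Rightarrow> ('w, 'a) aux" where
  "initial_aux S X i = (embed_measure (S i) Inl, \<lambda>p. Inl (src X i p))"

definition orderings :: "nat \<Rightarrow> nat \<Rightarrow> (nat \<Rightarrow> nat) set" where
  "orderings n i = {\<pi>. bij_betw \<pi> {1..n - 1} ({1..n} - {i})}"

definition terminal_aux_ord ::
  "'w measure \<Rightarrow> nat \<Rightarrow> (nat \<Rightarrow> 'a measure) \<Rightarrow> (nat \<Rightarrow> 'w \<Rightarrow> 'a) \<Rightarrow> nat \<Rightarrow> (nat \<Rightarrow> nat)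
    \<Rightarrow> ('w, 'a) aux set" where
  "terminal_aux_ord M n S X i \<pi> =
     {T (n - 1) | T. T 1 = initial_aux S X i
                   \<and> (\<forall>l\<in>{1..n - 2}. T (l + 1) \<in> minimizers M n S X l (T l) \<pi>)}"

definition terminal_aux ::
  "'w measure \<Rightarrow> nat \<Rightarrow> (nat \<Rightarrow> 'a measure) \<Rightarrow> (nat \<Rightarrow> 'w \<Rightarrow> 'a) \<Rightarrow> nat \<Rightarrow> ('w, 'a) aux set" where
  "terminal_aux M n S X i = (\<Union>\<pi>\<in>orderings n i. terminal_aux_ord M n S X i \<pi>)"

(* The higher-order common information R(X 1, ..., X n), for n \<ge> 2. *)
definition HCI ::
  "'w measure \<Rightarrow> nat \<Rightarrow> (nat \<Rightarrow> 'a measure) \<Rightarrow> (nat \<Rightarrow> 'w \<Rightarrow> 'a) \<Rightarrow> ennreal" where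
  "HCI M n S X =
     (MIN i\<in>{1..n}. SUP T\<in>terminal_aux M n S X i. MIN j\<in>{1..n}. info_src M S X T j)"

end

theory Submission
  imports Defs
begin

text \<open>For n = 2 no refinement step takes place, so HCI is the minimum of I(X_i; X_j) over all i, j.
  It remains to see that I(X; Y) is at most I(X; X), also where entropies are infinite and alphabets
  are arbitrary. If the law of (X, X) has density f with respect to the product of the marginals,
  then the law of (X, (X, Y)) has density f(x, x') at (x, (x', y)), hence the same relative entropy.
  The data processing inequality for the projection to (x, y) concludes.\<close>

section \<open>Relative entropy and densities\<close>

text \<open>Same convention as in \<open>mutual_info\<close>, but for any two measures, so that data
  processing can be stated without reference to joint laws and marginals.\<close>

definition relative_entropy :: "'a measure \<Rightarrow> 'a measure \<Rightarrow> ennreal" where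
  "relative_entropy Q P =
     (if absolutely_continuous Q P \<and> integrable P (entropy_density 2 Q P)
      then ennreal (KL_divergence 2 Q P) else \<infinity>)"

lemma mutual_info_eq_relative_entropy:
  assumes "prob_space M"
  shows "mutual_info M A B X Y =
    relative_entropy (distr M A X \<Otimes>\<^sub>M distr M B Y) (distr M (A \<Otimes>\<^sub>M B) (\<lambda>w. (X w, Y w)))"
  unfolding mutual_info_def relative_entropy_def Let_def
    prob_space.mutual_information_def[OF assms] ..

text \<open>Densities are unique \<open>Q\<close>-almost everywhere, hence \<open>P\<close>-almost
  everywhere by absolute continuity. An explicit \<open>f\<close> may therefore replace
  \<open>RN_deriv\<close> both in the integrability test and in the integral.\<close>

lemma relative_entropy_density:
  fixes f :: "'a \<Rightarrow> real"
  assumes "prob_space Q" and f[measurable]: "f \<in> borel_measurable Q"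
    and P: "P = density Q (\<lambda>x. ennreal (f x))" and nonneg: "\<And>x. 0 \<le> f x"
  shows "relative_entropy Q P =
    (if integrable P (\<lambda>x. log 2 (f x)) then ennreal (\<integral>x. log 2 (f x) \<partial>P) else \<infinity>)"
proof -
  interpret Q: prob_space Q by fact
  have ac: "absolutely_continuous Q P"
    unfolding P by (rule absolutely_continuousI_density) simp
  have "AE x in Q. ennreal (f x) = RN_deriv Q P x"
    using f P[symmetric] by (intro Q.RN_deriv_unique) simp_all
  then have "AE x in Q. RN_deriv Q P x = ennreal (f x)" by eventually_elim (rule sym)
  then have "AE x in Q. entropy_density 2 Q P x = log 2 (f x)"
    by eventually_elim (simp add: entropy_density_def nonneg)
  then have AE: "AE x in P. entropy_density 2 Q P x = log 2 (f x)"
    by (intro absolutely_continuous_AE[OF _ ac]) (simp_all add: P)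
  have [measurable]: "entropy_density 2 Q P \<in> borel_measurable P"
    by (auto simp: P intro: measurable_entropy_density)
  have [measurable]: "(\<lambda>x. log 2 (f x)) \<in> borel_measurable P" by (simp add: P)
  have "integrable P (entropy_density 2 Q P) \<longleftrightarrow> integrable P (\<lambda>x. log 2 (f x))"
    by (rule integrable_cong_AE) (use AE in simp_all)
  moreover have "KL_divergence 2 Q P = (\<integral>x. log 2 (f x) \<partial>P)"
    unfolding KL_divergence_def by (rule integral_cong_AE) (use AE in simp_all)
  ultimately show ?thesis using ac by (simp add: relative_entropy_def)
qed

text \<open>Supplies a version of the Radon-Nikodym derivative on which logarithms can be computed:
  real-valued and nonnegative everywhere, positive \<open>P\<close>-almost everywhere.\<close>

lemma obtain_real_density:
  assumes "prob_space Q" "prob_space P" "sets P = sets Q" "absolutely_continuous Q P"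
  obtains f :: "'a \<Rightarrow> real" where "f \<in> borel_measurable Q"
    "P = density Q (\<lambda>x. ennreal (f x))" "AE x in P. 0 < f x" "\<And>x. 0 \<le> f x"
proof -
  interpret Q: prob_space Q by fact
  interpret P: prob_space P by fact
  obtain f :: "'a \<Rightarrow> real" where f: "f \<in> borel_measurable Q"
    "AE x in Q. RN_deriv Q P x = ennreal (f x)" "AE x in P. 0 < f x" "\<And>x. 0 \<le> f x"
    using Q.real_RN_deriv[OF P.finite_measure_axioms assms(4,3)] by metis
  have "P = density Q (RN_deriv Q P)" by (rule Q.density_RN_deriv[OF assms(4,3), symmetric])
  also have "\<dots> = density Q (\<lambda>x. ennreal (f x))"
    by (rule density_cong) (use f in auto)
  finally show ?thesis using f that by blast
qed

section \<open>The data processing inequality\<close>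

text \<open>Let \<open>f\<close> be the density of \<open>P\<close> and \<open>g\<close> that of the
  image of \<open>P\<close>, and put r = g(T x) / f x. Then ln r \<le> r - 1 and r has
  \<open>P\<close>-integral at most 1, so integrating gives the inequality of the log densities.
  Integrability of log g(T x) has to be shown as well, since otherwise the left side would be
  infinite.\<close>

lemma relative_entropy_distr_le:
  assumes Q: "prob_space Q" and P: "prob_space P" and sets[measurable_cong]: "sets P = sets Q"
    and T[measurable]: "T \<in> measurable Q N"
  shows "relative_entropy (distr Q N T) (distr P N T) \<le> relative_entropy Q P"
proof (cases "absolutely_continuous Q P \<and> integrable P (entropy_density 2 Q P)")
  case True
  then have ac: "absolutely_continuous Q P" by simp
  let ?Q = "distr Q N T" and ?P = "distr P N T"
  interpret Q: prob_space Q by fact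
  interpret P: prob_space P by fact
  have T'[measurable]: "T \<in> measurable P N" by measurable
  have Q': "prob_space ?Q" by (rule Q.prob_space_distr) simp
  have P': "prob_space ?P" by (rule P.prob_space_distr) simp
  have "space P = space Q" using sets by (rule sets_eq_imp_space_eq)
  then have ac': "absolutely_continuous ?Q ?P"
    using ac by (auto simp: absolutely_continuous_def null_sets_distr_iff)
  obtain f :: "'a \<Rightarrow> real" where f[measurable]: "f \<in> borel_measurable Q"
    and Pf: "P = density Q (\<lambda>x. ennreal (f x))" and fpos: "AE x in P. 0 < f x"
    and f0: "\<And>x. 0 \<le> f x"
    using obtain_real_density[OF Q P sets ac] by blast
  obtain g :: "'b \<Rightarrow> real" where g': "g \<in> borel_measurable ?Q"
    and Pg: "?P = density ?Q (\<lambda>x. ennreal (g x))" and "AE x in ?P. 0 < g x"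
    and g0: "\<And>x. 0 \<le> g x"
    using obtain_real_density[OF Q' P' _ ac'] by auto
  then have [measurable]: "g \<in> borel_measurable N" and gpos: "AE x in P. 0 < g (T x)"
    by (auto simp: AE_distr_iff)
  have [measurable]: "f \<in> borel_measurable P" by measurable
  have relf: "relative_entropy Q P =
      (if integrable P (\<lambda>x. log 2 (f x)) then ennreal (\<integral>x. log 2 (f x) \<partial>P) else \<infinity>)"
    by (rule relative_entropy_density[OF Q f Pf f0])
  have relg: "relative_entropy ?Q ?P =
      (if integrable P (\<lambda>x. log 2 (g (T x))) then ennreal (\<integral>x. log 2 (g (T x)) \<partial>P) else \<infinity>)"
    by (subst relative_entropy_density[OF Q' g' Pg g0]) (simp add: integrable_distr_eq integral_distr)
  have "relative_entropy Q P \<noteq> \<infinity>" using True by (simp add: relative_entropy_def)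
  then have intf: "integrable P (\<lambda>x. log 2 (f x))" using relf by (auto split: if_splits)
  define r where "r x = g (T x) / f x" for x
  have [measurable]: "r \<in> borel_measurable P" unfolding r_def by measurable
  have r0: "0 \<le> r x" for x using f0 g0 by (simp add: r_def)
  have "(\<integral>\<^sup>+x. ennreal (r x) \<partial>P) = (\<integral>\<^sup>+x. ennreal (f x) * ennreal (r x) \<partial>Q)"
    unfolding Pf by (rule nn_integral_density) (simp_all add: r_def)
  \<comment> \<open>The product f x * r x is g (T x) where f x > 0. Where f x = 0 it is 0, so only
    an inequality results.\<close>
  also have "\<dots> \<le> (\<integral>\<^sup>+x. ennreal (g (T x)) \<partial>Q)"
    using f0 g0 by (intro nn_integral_mono) (simp add: r_def ennreal_mult[symmetric])
  also have "\<dots> = (\<integral>\<^sup>+x. ennreal (g x) \<partial>?Q)" by (simp add: nn_integral_distr)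
  also have "\<dots> = emeasure ?P (space ?P)"
    by (subst Pg) (simp add: emeasure_density nn_integral_distr cong: nn_integral_cong_simp)
  also have "\<dots> = 1" using P' by (rule prob_space.emeasure_space_1)
  finally have r1: "(\<integral>\<^sup>+x. ennreal (r x) \<partial>P) \<le> 1" .
  have intr: "integrable P r"
    using r1 r0 by (intro integrableI_nonneg) (auto simp: less_top[symmetric] top_unique)
  have intr1: "(\<integral>x. r x \<partial>P) \<le> 1"
    using r1 r0 by (simp add: nn_integral_eq_integral[OF intr])
  \<comment> \<open>This is ln r \<le> r - 1 divided by ln 2; positivity of both densities makes ln
    r a difference of logarithms.\<close>
  have upper: "AE x in P. log 2 (g (T x)) \<le> log 2 (f x) + (r x - 1) / ln 2"
    using fpos gpos
  proof eventually_elim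
    case (elim x)
    then have "ln (g (T x)) - ln (f x) \<le> r x - 1"
      using ln_le_minus_one[of "r x"] by (simp add: r_def ln_div)
    then show ?case by (simp add: log_def divide_simps)
  qed
  \<comment> \<open>The negative part of log g. Its integral under the image of \<open>P\<close> is
    that of g * m under the image of \<open>Q\<close>, and -t ln t \<le> 1 for t > 0 bounds g * m by
    the constant 1 / ln 2.\<close>
  define m where "m y = max 0 (- log 2 (g y))" for y
  have [measurable]: "m \<in> borel_measurable N" unfolding m_def by measurable
  have "g y * m y \<le> 1 / ln 2" for y
  proof (cases "0 < g y")
    case True
    then have "g y * - ln (g y) \<le> g y * (1 / g y - 1)"
      using ln_le_minus_one[of "1 / g y"] by (intro mult_left_mono) (simp_all add: ln_div)
    also have "\<dots> \<le> 1" using True by (simp add: right_diff_distrib)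
    finally show ?thesis using True by (auto simp: m_def log_def max_def divide_simps)
  next
    case False
    then show ?thesis using g0[of y] by simp
  qed
  then have gm: "ennreal (g y) * ennreal (m y) \<le> ennreal (1 / ln 2)" for y
    using g0[of y] by (simp add: ennreal_mult'[symmetric] ennreal_leI)
  have "(\<integral>\<^sup>+x. ennreal (m (T x)) \<partial>P) = (\<integral>\<^sup>+y. ennreal (m y) \<partial>?P)"
    by (simp add: nn_integral_distr)
  also have "\<dots> = (\<integral>\<^sup>+y. ennreal (g y) * ennreal (m y) \<partial>?Q)"
    by (subst Pg, rule nn_integral_density) simp_all
  also have "\<dots> \<le> (\<integral>\<^sup>+y. ennreal (1 / ln 2) \<partial>?Q)" by (intro nn_integral_mono gm)
  also have "\<dots> = ennreal (1 / ln 2)" using prob_space.emeasure_space_1[OF Q'] by simp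
  also have "\<dots> < \<infinity>" by simp
  finally have intm: "integrable P (\<lambda>x. m (T x))"
    by (intro integrableI_nonneg) (auto simp: m_def)
  have intg: "integrable P (\<lambda>x. log 2 (g (T x)))"
  \<comment> \<open>The first two terms of the dominating function control log g(T x) from above
    through \<open>upper\<close>; the third controls it from below.\<close>
  proof (rule Bochner_Integration.integrable_bound)
    show "integrable P (\<lambda>x. \<bar>log 2 (f x)\<bar> + r x / ln 2 + m (T x))"
      using intf intr intm by simp
    show "AE x in P. norm (log 2 (g (T x))) \<le> norm (\<bar>log 2 (f x)\<bar> + r x / ln 2 + m (T x))"
      using upper
    proof eventually_elim
      case (elim x)
      moreover have "(r x - 1) / ln 2 \<le> r x / ln 2" by (simp add: divide_right_mono)
      moreover have "0 \<le> r x / ln 2" using r0 by simp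
      ultimately show ?case by (auto simp: m_def max_def abs_if)
    qed
  qed simp
  have "(\<integral>x. log 2 (g (T x)) \<partial>P) \<le> (\<integral>x. log 2 (f x) + (r x - 1) / ln 2 \<partial>P)"
    using intf intr upper by (intro integral_mono_AE intg) simp_all
  also have "\<dots> = (\<integral>x. log 2 (f x) \<partial>P) + ((\<integral>x. r x \<partial>P) - 1) / ln 2"
    using intf intr P.prob_space by simp
  also have "\<dots> \<le> (\<integral>x. log 2 (f x) \<partial>P)" using intr1 by (simp add: divide_le_0_iff)
  finally show ?thesis using intf intg by (simp add: relf relg ennreal_leI)
next
  case False
  then have "relative_entropy Q P = \<infinity>" unfolding relative_entropy_def by (rule if_not_P)
  then show ?thesis by simp
qed

section \<open>Mutual information under maps of the variables\<close>

text \<open>The map (x, y) \<mapsto> (g x, h y) sends the product of the marginals to the product of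
  the new marginals and the joint law to the new joint law, so data processing applies.\<close>

lemma mutual_info_comp_le:
  assumes M: "prob_space M"
    and X[measurable]: "X \<in> measurable M A" and Y[measurable]: "Y \<in> measurable M B"
    and g[measurable]: "g \<in> measurable A A'" and h[measurable]: "h \<in> measurable B B'"
  shows "mutual_info M A' B' (\<lambda>w. g (X w)) (\<lambda>w. h (Y w)) \<le> mutual_info M A B X Y"
proof -
  interpret prob_space M by fact
  let ?Q = "distr M A X \<Otimes>\<^sub>M distr M B Y" and ?P = "distr M (A \<Otimes>\<^sub>M B) (\<lambda>w. (X w, Y w))"
  let ?T = "\<lambda>(x, y). (g x, h y)"
  interpret X: prob_space "distr M A X" by (rule prob_space_distr) simp
  interpret Y: prob_space "distr M B Y" by (rule prob_space_distr) simp
  interpret XY: pair_prob_space "distr M A X" "distr M B Y" ..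
  \<comment> \<open>Sigma-finiteness of the second image measure is a premise for writing the
    product of image measures as the image of the product.\<close>
  have "distr (distr M B Y) B' h = distr M B' (\<lambda>w. h (Y w))"
    by (simp add: distr_distr comp_def)
  moreover have "prob_space (distr M B' (\<lambda>w. h (Y w)))" by (rule prob_space_distr) simp
  ultimately have "sigma_finite_measure (distr (distr M B Y) B' h)"
    by (simp add: prob_space_imp_sigma_finite)
  then have Q: "distr M A' (\<lambda>w. g (X w)) \<Otimes>\<^sub>M distr M B' (\<lambda>w. h (Y w)) =
      distr ?Q (A' \<Otimes>\<^sub>M B') ?T"
    by (subst pair_measure_distr[symmetric]) (simp_all add: distr_distr comp_def)
  have P: "distr M (A' \<Otimes>\<^sub>M B') (\<lambda>w. (g (X w), h (Y w))) = distr ?P (A' \<Otimes>\<^sub>M B') ?T"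
    by (simp add: distr_distr comp_def)
  have "prob_space ?P" by (rule prob_space_distr) simp
  moreover have "sets ?P = sets ?Q" by (simp cong: sets_pair_measure_cong)
  moreover have "?T \<in> measurable ?Q (A' \<Otimes>\<^sub>M B')" by simp
  ultimately show ?thesis
    unfolding mutual_info_eq_relative_entropy[OF M] Q P
    by (intro relative_entropy_distr_le XY.prob_space_axioms)
qed

text \<open>Data processing for the coordinate swap. Exchanging the roles of the variables gives the
  converse, hence symmetry.\<close>

lemma mutual_info_commute_le:
  assumes M: "prob_space M"
    and X[measurable]: "X \<in> measurable M A" and Y[measurable]: "Y \<in> measurable M B"
  shows "mutual_info M B A Y X \<le> mutual_info M A B X Y"
proof -
  interpret prob_space M by fact
  let ?Q = "distr M A X \<Otimes>\<^sub>M distr M B Y" and ?P = "distr M (A \<Otimes>\<^sub>M B) (\<lambda>w. (X w, Y w))"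
  let ?T = "\<lambda>(x, y). (y, x)"
  interpret X: prob_space "distr M A X" by (rule prob_space_distr) simp
  interpret Y: prob_space "distr M B Y" by (rule prob_space_distr) simp
  interpret XY: pair_prob_space "distr M A X" "distr M B Y" ..
  interpret YX: pair_sigma_finite "distr M B Y" "distr M A X" ..
  have Q: "distr M B Y \<Otimes>\<^sub>M distr M A X = distr ?Q (B \<Otimes>\<^sub>M A) ?T"
    by (subst YX.distr_pair_swap) (intro distr_cong, auto cong: sets_pair_measure_cong)
  have P: "distr M (B \<Otimes>\<^sub>M A) (\<lambda>w. (Y w, X w)) = distr ?P (B \<Otimes>\<^sub>M A) ?T"
    by (simp add: distr_distr comp_def)
  have "prob_space ?P" by (rule prob_space_distr) simp
  moreover have "sets ?P = sets ?Q" by (simp cong: sets_pair_measure_cong)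
  moreover have "?T \<in> measurable ?Q (B \<Otimes>\<^sub>M A)" by simp
  ultimately show ?thesis
    unfolding mutual_info_eq_relative_entropy[OF M] Q P
    by (intro relative_entropy_distr_le XY.prob_space_axioms)
qed

lemma mutual_info_commute:
  assumes "prob_space M" "X \<in> measurable M A" "Y \<in> measurable M B"
  shows "mutual_info M B A Y X = mutual_info M A B X Y"
  using assms by (intro antisym mutual_info_commute_le)

section \<open>Comparison with the self-information I(X; X)\<close>

lemma mutual_info_joint_le_self:
  assumes M: "prob_space M"
    and X[measurable]: "X \<in> measurable M A" and Y[measurable]: "Y \<in> measurable M B"
  shows "mutual_info M A (A \<Otimes>\<^sub>M B) X (\<lambda>w. (X w, Y w)) \<le> mutual_info M A A X X"
proof -
  interpret prob_space M by fact
  let ?Z = "\<lambda>w. (X w, Y w)"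
  let ?PX = "distr M A X" and ?PZ = "distr M (A \<Otimes>\<^sub>M B) ?Z"
  let ?Q = "?PX \<Otimes>\<^sub>M ?PX" and ?P = "distr M (A \<Otimes>\<^sub>M A) (\<lambda>w. (X w, X w))"
  let ?Q' = "?PX \<Otimes>\<^sub>M ?PZ" and ?P' = "distr M (A \<Otimes>\<^sub>M (A \<Otimes>\<^sub>M B)) (\<lambda>w. (X w, ?Z w))"
  interpret X: prob_space ?PX by (rule prob_space_distr) simp
  interpret Z: prob_space ?PZ by (rule prob_space_distr) simp
  interpret XX: pair_prob_space ?PX ?PX ..
  interpret XZ: pair_prob_space ?PX ?PZ ..
  have P: "prob_space ?P" by (rule prob_space_distr) simp
  have setsQ: "sets ?Q = sets (A \<Otimes>\<^sub>M A)" "sets ?Q' = sets (A \<Otimes>\<^sub>M (A \<Otimes>\<^sub>M B))"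
    by (rule sets_pair_measure_cong[OF sets_distr sets_distr])+
  show ?thesis
  proof (cases "absolutely_continuous ?Q ?P")
    case True
    have "sets ?P = sets ?Q" unfolding setsQ(1) by (rule sets_distr)
    then obtain f :: "'b \<times> 'b \<Rightarrow> real" where f: "f \<in> borel_measurable ?Q"
      and Pf: "?P = density ?Q (\<lambda>x. ennreal (f x))" and f0: "\<And>x. 0 \<le> f x"
      using obtain_real_density[OF XX.prob_space_axioms P _ True] by blast
    have [measurable]: "f \<in> borel_measurable (A \<Otimes>\<^sub>M A)"
      using f unfolding measurable_cong_sets[OF setsQ(1) refl] .
    \<comment> \<open>The inner integral is the conditional probability of the first coordinate
      lying in C given that the second is x'. As the law of (X, X) sits on the diagonal, it must be
      the indicator of C. Both sides have the same integral over every D, namely the probability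
      that X lies in C \<inter> D. The exceptional null set may depend on C; this is harmless, since
      rectangles are treated one at a time below.\<close>
    have marginal: "AE x' in ?PX. (\<integral>\<^sup>+x. indicator C x * ennreal (f (x, x')) \<partial>?PX) = indicator C x'"
      if [measurable]: "C \<in> sets A" for C
    proof (rule X.density_unique_finite_measure)
      fix D assume "D \<in> sets ?PX"
      then have [measurable]: "D \<in> sets A" by simp
      have "(\<integral>\<^sup>+x'. (\<integral>\<^sup>+x. indicator C x * ennreal (f (x, x')) \<partial>?PX) * indicator D x' \<partial>?PX) =
          (\<integral>\<^sup>+x'. \<integral>\<^sup>+x. ennreal (f (x, x')) * indicator (C \<times> D) (x, x') \<partial>?PX \<partial>?PX)"
      proof (intro nn_integral_cong)
        fix x' assume "x' \<in> space ?PX"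
        then have [measurable]: "x' \<in> space A" by simp
        show "(\<integral>\<^sup>+x. indicator C x * ennreal (f (x, x')) \<partial>?PX) * indicator D x' =
            (\<integral>\<^sup>+x. ennreal (f (x, x')) * indicator (C \<times> D) (x, x') \<partial>?PX)"
          by (subst nn_integral_multc[symmetric]) (simp_all add: indicator_times mult_ac)
      qed
      also have "\<dots> = (\<integral>\<^sup>+p. ennreal (f p) * indicator (C \<times> D) p \<partial>?Q)"
        by (rule XX.nn_integral_snd) simp
      also have "\<dots> = emeasure ?P (C \<times> D)"
        by (subst Pf, subst emeasure_density) simp_all
      also have "\<dots> = emeasure ?PX (C \<inter> D)"
      proof -
        have "(\<lambda>w. (X w, X w)) -` (C \<times> D) \<inter> space M = X -` (C \<inter> D) \<inter> space M" by auto
        then show ?thesis by (simp add: emeasure_distr)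
      qed
      also have "\<dots> = (\<integral>\<^sup>+x'. indicator C x' * indicator D x' \<partial>?PX)"
        by (simp add: indicator_inter_arith[symmetric] flip: nn_integral_indicator)
      finally show "(\<integral>\<^sup>+x'. (\<integral>\<^sup>+x. indicator C x * ennreal (f (x, x')) \<partial>?PX) * indicator D x' \<partial>?PX) =
        (\<integral>\<^sup>+x'. indicator C x' * indicator D x' \<partial>?PX)" .
    qed simp_all
    let ?f' = "\<lambda>(x, z). f (x, fst z)"
    \<comment> \<open>The measures are compared on the intersection-stable family of measurable
      rectangles; the whole space is itself a rectangle of finite measure.\<close>
    have P': "?P' = density ?Q' (\<lambda>p. ennreal (?f' p))"
    proof (rule measure_eqI_generator_eq[where
          E = "{C \<times> D | C D. C \<in> sets A \<and> D \<in> sets (A \<Otimes>\<^sub>M B)}" and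
          \<Omega> = "space A \<times> space (A \<Otimes>\<^sub>M B)" and A = "\<lambda>_. space A \<times> space (A \<Otimes>\<^sub>M B)"])
      show "Int_stable {C \<times> D | C D. C \<in> sets A \<and> D \<in> sets (A \<Otimes>\<^sub>M B)}"
        by (rule Int_stable_pair_measure_generator)
      show "{C \<times> D | C D. C \<in> sets A \<and> D \<in> sets (A \<Otimes>\<^sub>M B)} \<subseteq> Pow (space A \<times> space (A \<Otimes>\<^sub>M B))"
        by (rule pair_measure_closed)
      show "emeasure ?P' W = emeasure (density ?Q' (\<lambda>p. ennreal (?f' p))) W"
        if W: "W \<in> {C \<times> D | C D. C \<in> sets A \<and> D \<in> sets (A \<Otimes>\<^sub>M B)}" for W
      proof -
        obtain C D where W: "W = C \<times> D"
          and [measurable]: "C \<in> sets A" "D \<in> sets (A \<Otimes>\<^sub>M B)" using W by auto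
        \<comment> \<open>The identity is pulled back along X to the sample space and then
          transported to the law of \<open>?Z\<close>, whose first component is X.\<close>
        have "AE w in M. (\<integral>\<^sup>+x. indicator C x * ennreal (f (x, X w)) \<partial>?PX) = indicator C (X w)"
          using marginal[of C] by (simp add: AE_distr_iff)
        then have AE: "AE z in ?PZ. (\<integral>\<^sup>+x. indicator C x * ennreal (f (x, fst z)) \<partial>?PX) = indicator C (fst z)"
          by (simp add: AE_distr_iff)
        have "emeasure (density ?Q' (\<lambda>p. ennreal (?f' p))) W =
            (\<integral>\<^sup>+p. ennreal (?f' p) * indicator (C \<times> D) p \<partial>?Q')"
          unfolding W by (rule emeasure_density) simp_all
        \<comment> \<open>Fubini with z outermost, so that for fixed z the integral over x is the
          one in \<open>marginal\<close>, taken at fst z.\<close>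
        also have "\<dots> = (\<integral>\<^sup>+z. \<integral>\<^sup>+x. ennreal (f (x, fst z)) * indicator (C \<times> D) (x, z) \<partial>?PX \<partial>?PZ)"
          by (subst XZ.nn_integral_snd[symmetric]) simp_all
        also have "\<dots> = (\<integral>\<^sup>+z. (\<integral>\<^sup>+x. indicator C x * ennreal (f (x, fst z)) \<partial>?PX) * indicator D z \<partial>?PZ)"
        proof (intro nn_integral_cong)
          fix z assume "z \<in> space ?PZ"
          then have [measurable]: "fst z \<in> space A" by (auto simp: space_pair_measure)
          show "(\<integral>\<^sup>+x. ennreal (f (x, fst z)) * indicator (C \<times> D) (x, z) \<partial>?PX) =
              (\<integral>\<^sup>+x. indicator C x * ennreal (f (x, fst z)) \<partial>?PX) * indicator D z"
            by (subst nn_integral_multc[symmetric]) (simp_all add: indicator_times mult_ac)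
        qed
        also have "\<dots> = (\<integral>\<^sup>+z. indicator C (fst z) * indicator D z \<partial>?PZ)"
          by (rule nn_integral_cong_AE) (use AE in auto)
        also have "\<dots> = (\<integral>\<^sup>+w. indicator (C \<times> D) (X w, ?Z w) \<partial>M)"
          by (subst nn_integral_distr) (simp_all add: indicator_times)
        also have "\<dots> = (\<integral>\<^sup>+p. indicator (C \<times> D) p \<partial>?P')"
          by (subst nn_integral_distr) simp_all
        also have "\<dots> = emeasure ?P' W"
          unfolding W by (rule nn_integral_indicator) simp
        finally show ?thesis ..
      qed
      show "sets ?P' = sigma_sets (space A \<times> space (A \<Otimes>\<^sub>M B)) {C \<times> D | C D. C \<in> sets A \<and> D \<in> sets (A \<Otimes>\<^sub>M B)}"
        by (simp add: sets_pair_measure)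
      show "sets (density ?Q' (\<lambda>p. ennreal (?f' p))) =
          sigma_sets (space A \<times> space (A \<Otimes>\<^sub>M B)) {C \<times> D | C D. C \<in> sets A \<and> D \<in> sets (A \<Otimes>\<^sub>M B)}"
        using setsQ(2) by (simp add: sets_pair_measure)
      have "prob_space ?P'" by (rule prob_space_distr) simp
      then show "emeasure ?P' (space A \<times> space (A \<Otimes>\<^sub>M B)) \<noteq> \<infinity>"
        by (simp add: finite_measure.emeasure_eq_measure prob_space_def)
    qed auto
    have "relative_entropy ?Q ?P =
      (if integrable ?P (\<lambda>x. log 2 (f x)) then ennreal (\<integral>x. log 2 (f x) \<partial>?P) else \<infinity>)"
      by (rule relative_entropy_density[OF XX.prob_space_axioms f Pf f0])
    moreover have "relative_entropy ?Q' ?P' =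
      (if integrable ?P' (\<lambda>x. log 2 (?f' x)) then ennreal (\<integral>x. log 2 (?f' x) \<partial>?P') else \<infinity>)"
      by (rule relative_entropy_density[OF XZ.prob_space_axioms _ P']) (use f0 in auto)
    moreover have "(\<lambda>x. log 2 (?f' x)) \<in> borel_measurable (A \<Otimes>\<^sub>M (A \<Otimes>\<^sub>M B))" by measurable
    moreover have "(\<lambda>x. log 2 (f x)) \<in> borel_measurable (A \<Otimes>\<^sub>M A)" by measurable
    \<comment> \<open>Pulled back to the sample space, both log densities become log 2 (f (X w, X
      w)), so integrability and integrals agree.\<close>
    ultimately show ?thesis
      unfolding mutual_info_eq_relative_entropy[OF M]
      by (simp add: integrable_distr_eq integral_distr)
  qed (simp add: mutual_info_eq_relative_entropy[OF M] relative_entropy_def)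
qed

lemma mutual_info_le_self:
  assumes "prob_space M"
    and [measurable]: "X \<in> measurable M A" "Y \<in> measurable M B"
  shows "mutual_info M A B X Y \<le> mutual_info M A A X X"
proof -
  have "mutual_info M A B X Y \<le> mutual_info M A (A \<Otimes>\<^sub>M B) X (\<lambda>w. (X w, Y w))"
    using mutual_info_comp_le[OF assms(1,2), of "\<lambda>w. (X w, Y w)" "A \<Otimes>\<^sub>M B" id A snd B] by simp
  also have "\<dots> \<le> mutual_info M A A X X"
    using assms by (rule mutual_info_joint_le_self)
  finally show ?thesis .
qed

section \<open>Sources as auxiliary variables on the extended space\<close>

text \<open>\<open>Inl\<close> and its left inverse \<open>projl\<close> are both measurable, so
  data processing holds in both directions.\<close>

lemma mutual_info_embed_Inl:
  assumes "prob_space M"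
    and [measurable]: "X \<in> measurable M A" "Y \<in> measurable M B"
  shows "mutual_info M (embed_measure A Inl) B (\<lambda>w. Inl (X w)) Y = mutual_info M A B X Y"
proof (rule antisym)
  have Inl[measurable]: "Inl \<in> measurable A (embed_measure A Inl)"
    by (rule measurable_embed_measure2) simp
  have Inv: "projl \<in> measurable (embed_measure A Inl) A"
    by (rule measurable_embed_measure1) simp
  show "mutual_info M (embed_measure A Inl) B (\<lambda>w. Inl (X w)) Y \<le> mutual_info M A B X Y"
    using mutual_info_comp_le[OF assms Inl measurable_ident] by simp
  show "mutual_info M A B X Y \<le> mutual_info M (embed_measure A Inl) B (\<lambda>w. Inl (X w)) Y"
    using mutual_info_comp_le[OF assms(1) _ assms(3) Inv measurable_ident, of "\<lambda>w. Inl (X w)"] by simp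
qed

text \<open>The first projection of a product with a probability measure has law \<open>M\<close>,
  so adjoining independent randomness leaves the joint law and the marginals unchanged.\<close>

lemma mutual_info_fst:
  assumes "prob_space M" "prob_space N"
    and [measurable]: "X \<in> measurable M A" "Y \<in> measurable M B"
  shows "mutual_info (M \<Otimes>\<^sub>M N) A B (\<lambda>p. X (fst p)) (\<lambda>p. Y (fst p)) = mutual_info M A B X Y"
proof -
  interpret M: prob_space M by fact
  interpret N: prob_space N by fact
  interpret pair_prob_space M N ..
  have "distr (M \<Otimes>\<^sub>M N) (A \<Otimes>\<^sub>M B) (\<lambda>p. (X (fst p), Y (fst p))) =
      distr M (A \<Otimes>\<^sub>M B) (\<lambda>w. (X w, Y w))"
    using distr_distr[of "\<lambda>w. (X w, Y w)" M "A \<Otimes>\<^sub>M B" fst "M \<Otimes>\<^sub>M N"] by (simp add: N.distr_pair_fst comp_def)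
  moreover have "distr (M \<Otimes>\<^sub>M N) A (\<lambda>p. X (fst p)) = distr M A X"
    using distr_distr[of X M A fst "M \<Otimes>\<^sub>M N"] by (simp add: N.distr_pair_fst comp_def)
  moreover have "distr (M \<Otimes>\<^sub>M N) B (\<lambda>p. Y (fst p)) = distr M B Y"
    using distr_distr[of Y M B fst "M \<Otimes>\<^sub>M N"] by (simp add: N.distr_pair_fst comp_def)
  ultimately show ?thesis
    by (simp add: mutual_info_eq_relative_entropy assms(1) prob_space_axioms)
qed

lemma info_src_initial_aux:
  fixes X :: "nat \<Rightarrow> 'w \<Rightarrow> 'a"
  assumes M: "prob_space M" and X: "X i \<in> measurable M (S i)" "X j \<in> measurable M (S j)"
  shows "info_src M S X (initial_aux S X i) j = mutual_info M (S i) (S j) (X i) (X j)"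
proof -
  let ?U = "\<Pi>\<^sub>M k\<in>(UNIV :: nat set). uniform_measure lborel {0..1::real}"
  have U: "prob_space ?U"
    by (intro prob_space_PiM prob_space_uniform_measure) simp_all
  interpret M: prob_space M by fact
  interpret U: prob_space ?U by fact
  interpret pair_prob_space M ?U ..
  have "info_src M S X (initial_aux S X i) j =
      mutual_info (M \<Otimes>\<^sub>M ?U) (embed_measure (S i) Inl) (S j)
        (\<lambda>p. Inl (X i (fst p)) :: 'a + real) (\<lambda>p. X j (fst p))"
    by (simp add: info_src_def initial_aux_def src_def ext_space_def)
  also have "\<dots> = mutual_info (M \<Otimes>\<^sub>M ?U) (S i) (S j) (\<lambda>p. X i (fst p)) (\<lambda>p. X j (fst p))"
    by (rule mutual_info_embed_Inl[OF prob_space_axioms])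
      (use X in \<open>auto intro: measurable_compose[OF measurable_fst]\<close>)
  also have "\<dots> = mutual_info M (S i) (S j) (X i) (X j)"
    by (rule mutual_info_fst[OF M U X])
  finally show ?thesis .
qed

section \<open>Evaluation for two sources\<close>

text \<open>For n = 2 the range {1..n - 2} of refinement steps is empty and the terminal index n - 1
  is 1, so only the condition on T 1 remains.\<close>

lemma terminal_aux_2:
  assumes "i \<in> {1..2}"
  shows "terminal_aux M 2 S X i = {initial_aux S X i}"
proof -
  \<comment> \<open>\<open>3 - i\<close> is the other index in {1, 2}. This ordering shows that the
    union over orderings is nonempty.\<close>
  have "(\<lambda>_. 3 - i) \<in> orderings 2 i"
    using assms by (cases "i = 1") (auto simp: orderings_def bij_betw_def)
  moreover have "terminal_aux_ord M 2 S X i \<pi> = {initial_aux S X i}" for \<pi>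
    by (auto simp: terminal_aux_ord_def intro!: exI[of _ "\<lambda>_. initial_aux S X i"])
  ultimately show ?thesis by (auto simp: terminal_aux_def)
qed

theorem lemma1:
  fixes M :: "'w measure"
    and S :: "nat \<Rightarrow> 'a measure"
    and X :: "nat \<Rightarrow> 'w \<Rightarrow> 'a"
  assumes "prob_space M"
    and "X 1 \<in> measurable M (S 1)"
    and "X 2 \<in> measurable M (S 2)"
  shows "HCI M 2 S X = mutual_info M (S 1) (S 2) (X 1) (X 2)"
proof -
  let ?I = "\<lambda>i j. mutual_info M (S i) (S j) (X i) (X j)"
  have two: "{1..2} = {1, 2::nat}" by auto
  have meas: "X i \<in> measurable M (S i)" if "i \<in> {1..2}" for i
    using assms(2,3) that unfolding two by blast
  have "(SUP T\<in>terminal_aux M 2 S X i. MIN j\<in>{1..2}. info_src M S X T j) = (MIN j\<in>{1..2}. ?I i j)"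
    if "i \<in> {1..2}" for i
    using that meas
    by (simp add: terminal_aux_2 info_src_initial_aux[OF assms(1)] cong: image_cong_simp)
  then have "HCI M 2 S X = (MIN i\<in>{1..2}. MIN j\<in>{1..2}. ?I i j)"
    by (simp add: HCI_def cong: image_cong_simp)
  also have "\<dots> = min (min (?I 1 1) (?I 1 2)) (min (?I 2 1) (?I 2 2))"
    unfolding two by simp
  \<comment> \<open>The two mixed terms agree by symmetry, and each is at most the self-information
    in its row.\<close>
  also have "\<dots> = ?I 1 2"
    using mutual_info_commute[OF assms] mutual_info_le_self[OF assms]
      mutual_info_le_self[OF assms(1,3,2)]
    by (simp add: min_absorb1 min_absorb2)
  finally show ?thesis .
qed

end
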